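(* Let $\mathcal{A}$ and $\mathcal{B}$ be unital Banach algebras such that $\mathcal{B}$ is a right $\mathcal{A}$-module, and let $\varphi:\mathcal{A}\to\mathcal{B}$ be a unital pseudo $3$-Jordan homomorphism with a Jordan coefficient $w\in\mathcal{A}$ such that $w$ is a right separating point of $\mathcal{B}$. Suppose that $\mathcal{B}$ is commutative and that $\varphi(abcw)=\varphi(acbw)$ for all $a,b,c\in\mathcal{A}$. Then $\varphi$ is a homomorphism, i.e. $\varphi(ab)=\varphi(a)\varphi(b)$ for all $a,b\in\mathcal{A}$.
   Context: Banach algebras are complex and associative. For $\mathcal{B}$ a right $\mathcal{A}$-module (action written $b\cdot a$), a linear map $\varphi:\mathcal{A}\to\mathcal{B}$ is a pseudo $3$-Jordan homomorphism with Jordan coefficient $w\in\mathcal{A}$ if $\varphi(a^3 w)=\varphi(a)^3\cdot w$ for all $a\in\mathcal{A}$. The map $\varphi$ is unital if it maps the unit of $\mathcal{A}$ to the unit of $\mathcal{B}$. An element $w\in\mathcal{A}$ is a right separating point of $\mathcal{B}$ if $x\cdot w=0$ with $x\in\mathcal{B}$ implies $x=0$. *)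

theory Defs
  imports Complex_Main
begin

text \<open>
  The real scalar multiplication of the distribution's normed classes is required to be the
  restriction of the complex one.
\<close>

class complex_banach_space = banach +
  fixes scaleC :: "complex \<Rightarrow> 'a \<Rightarrow> 'a" (infixr "*\<^sub>C" 75)
  assumes scaleC_add_right: "c *\<^sub>C (x + y) = c *\<^sub>C x + c *\<^sub>C y"
    and scaleC_add_left: "(c + d) *\<^sub>C x = c *\<^sub>C x + d *\<^sub>C x"
    and scaleC_scaleC: "c *\<^sub>C d *\<^sub>C x = (c * d) *\<^sub>C x"
    and scaleC_of_real: "complex_of_real r *\<^sub>C x = r *\<^sub>R x"
    and norm_scaleC: "norm (c *\<^sub>C x) = cmod c * norm x"

text \<open>
  Submultiplicativity of the norm comes from \<^class>\<open>real_normed_algebra\<close>.  The unit comes from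
  \<^class>\<open>monoid_mult\<close> and not from \<^class>\<open>real_normed_algebra_1\<close>, so neither
  \<open>norm 1 = 1\<close> nor \<open>0 \<noteq> 1\<close> is imposed.
\<close>

class unital_complex_banach_algebra = complex_banach_space + real_normed_algebra + monoid_mult +
  assumes scaleC_mult_left: "(c *\<^sub>C x) * y = c *\<^sub>C (x * y)"
    and scaleC_mult_right: "x * (c *\<^sub>C y) = c *\<^sub>C (x * y)"

lemma vector_space_scaleC: "vector_space (scaleC :: complex \<Rightarrow> 'a::complex_banach_space \<Rightarrow> 'a)"
proof
  fix x :: 'a
  show "1 *\<^sub>C x = x"
    using scaleC_of_real[of 1 x] by simp
qed (simp_all add: scaleC_add_right scaleC_add_left scaleC_scaleC)

instantiation complex :: unital_complex_banach_algebra
begin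

definition scaleC_complex :: "complex \<Rightarrow> complex \<Rightarrow> complex"
  where "scaleC_complex c x = c * x"

instance
  by standard
    (simp_all add: scaleC_complex_def algebra_simps norm_mult scaleR_conv_of_real)

end

abbreviation clinear :: "('a::complex_banach_space \<Rightarrow> 'b::complex_banach_space) \<Rightarrow> bool"
  where "clinear \<equiv> Vector_Spaces.linear scaleC scaleC"

text \<open>
  A right module over an algebra, in the usual sense of Banach algebra theory: a complex-bilinear
  associative action.  Neither continuity of the action, nor \<open>b \<cdot> 1 = b\<close>, nor any compatibility
  with the multiplication of \<open>'b\<close> is part of the notion.
\<close>

definition right_module ::
    "('b::complex_banach_space \<Rightarrow> 'a::unital_complex_banach_algebra \<Rightarrow> 'b) \<Rightarrow> bool"
  where "right_module act \<longleftrightarrow>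
    (\<forall>a. clinear (\<lambda>b. act b a)) \<and> (\<forall>b. clinear (\<lambda>a. act b a)) \<and>
    (\<forall>b a a'. act b (a * a') = act (act b a) a')"

definition pseudo_3_jordan_hom ::
    "('b::unital_complex_banach_algebra \<Rightarrow> 'a::unital_complex_banach_algebra \<Rightarrow> 'b)
      \<Rightarrow> 'a \<Rightarrow> ('a \<Rightarrow> 'b) \<Rightarrow> bool"
  where "pseudo_3_jordan_hom act w \<phi> \<longleftrightarrow>
    clinear \<phi> \<and> (\<forall>a. \<phi> (a ^ 3 * w) = act (\<phi> a ^ 3) w)"

definition right_separating_point ::
    "('b::complex_banach_space \<Rightarrow> 'a::unital_complex_banach_algebra \<Rightarrow> 'b) \<Rightarrow> 'a \<Rightarrow> bool"
  where "right_separating_point act w \<longleftrightarrow> (\<forall>x. act x w = 0 \<longrightarrow> x = 0)"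

end

theory Submission
  imports Defs
begin

text \<open>
  Write \<open>T a = \<phi> (a * w)\<close> and \<open>R y = act y w\<close>.  Both are linear, \<open>R\<close> is injective because \<open>w\<close>
  separates points, and the Jordan condition reads \<open>T (a ^ 3) = R (\<phi> a ^ 3)\<close>.  Since \<open>\<phi>\<close> is
  unital, replacing \<open>a\<close> by \<open>a + 1\<close> or \<open>a - 1\<close> replaces \<open>\<phi> a\<close> by \<open>\<phi> a + 1\<close> or \<open>\<phi> a - 1\<close>.
  The identity elements commute with everything, so the binomial formula applies on both sides, and
  comparing the parts of each degree in \<open>a\<close> gives the linear and the quadratic identities
  \<open>T a = R (\<phi> a)\<close> and \<open>T (a * a) = R (\<phi> a * \<phi> a)\<close> (lemma \<open>cube_identity_descends\<close>).

  The linear identity turns every statement about \<open>T\<close> into one about \<open>R \<circ> \<phi>\<close>, and injectivity of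
  \<open>R\<close> removes \<open>R\<close>.  So \<open>\<phi> (a * a) = \<phi> a * \<phi> a\<close>, while the symmetry hypothesis with first
  factor \<open>1\<close>, which is \<open>T (b * c) = T (c * b)\<close>, becomes \<open>\<phi> (b * c) = \<phi> (c * b)\<close>.  Polarizing
  the square identity gives \<open>\<phi> (a * b) + \<phi> (b * a) = \<phi> a * \<phi> b + \<phi> b * \<phi> a\<close>.  By this symmetry
  of \<open>\<phi>\<close> on products and by commutativity of the target, the two sides are twice \<open>\<phi> (a * b)\<close> and
  twice \<open>\<phi> a * \<phi> b\<close>.
\<close>

lemma clinear_imp_linear:
  assumes "clinear f"
  shows "linear f"
proof -
  interpret Vector_Spaces.linear scaleC scaleC f by (rule assms)
  show ?thesis
  proof (rule linearI)
    show "f (x + y) = f x + f y" for x y by (rule add)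
    show "f (r *\<^sub>R x) = r *\<^sub>R f x" for r x
      using scale[of "complex_of_real r" x] by (simp add: scaleC_of_real)
  qed
qed

text \<open>
  In the sum of the two cubes the terms of even degree cancel, in the difference those of odd
  degree; what remains besides the wanted term is a cube, \<open>a ^ 3\<close> or \<open>1 = 1 ^ 3\<close>, so that each
  right-hand side is a linear combination of cubes.
\<close>

lemma cube_add_sub_one:
  fixes a :: "'a::{real_algebra,monoid_mult}"
  shows "(a + 1) ^ 3 + (a - 1) ^ 3 - 2 *\<^sub>R a ^ 3 = 6 *\<^sub>R a"
    and "(a + 1) ^ 3 - (a - 1) ^ 3 - 2 *\<^sub>R 1 = 6 *\<^sub>R (a * a)"
proof -
  have "6 *\<^sub>R x = (1 + 1 + 1 + 1 + 1 + 1) *\<^sub>R x" for x :: 'a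
    by simp
  then have six: "6 *\<^sub>R x = x + x + x + x + x + x" for x :: 'a
    by (simp only: scaleR_add_left scaleR_one)
  show "(a + 1) ^ 3 + (a - 1) ^ 3 - 2 *\<^sub>R a ^ 3 = 6 *\<^sub>R a"
    and "(a + 1) ^ 3 - (a - 1) ^ 3 - 2 *\<^sub>R 1 = 6 *\<^sub>R (a * a)"
    unfolding scaleR_2 six by (simp_all add: power3_eq_cube algebra_simps)
qed

text \<open>
  An identity between cubes descends to lower degrees, because a unital map carries the shifts by
  the unit in the source to those in the target.
\<close>

lemma cube_identity_descends:
  fixes \<phi> :: "'a::{real_algebra,monoid_mult} \<Rightarrow> 'b::{real_algebra,monoid_mult}"
    and T :: "'a \<Rightarrow> 'c::real_vector" and R :: "'b \<Rightarrow> 'c"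
  assumes "linear \<phi>" "linear T" "linear R"
    and unital: "\<phi> 1 = 1"
    and cube: "\<And>a. T (a ^ 3) = R (\<phi> a ^ 3)"
  shows "T a = R (\<phi> a)" and "T (a * a) = R (\<phi> a * \<phi> a)"
proof -
  have shift: "\<phi> (a + 1) = \<phi> a + 1" "\<phi> (a - 1) = \<phi> a - 1"
    using unital by (simp_all add: linear_add[OF \<open>linear \<phi>\<close>] linear_diff[OF \<open>linear \<phi>\<close>])
  note T = linear_add[OF \<open>linear T\<close>] linear_diff[OF \<open>linear T\<close>] linear_scale[OF \<open>linear T\<close>]
  note R = linear_add[OF \<open>linear R\<close>] linear_diff[OF \<open>linear R\<close>] linear_scale[OF \<open>linear R\<close>]
  have one: "T 1 = R 1"
    using cube[of 1] unital by simp
  have "6 *\<^sub>R T a = T ((a + 1) ^ 3 + (a - 1) ^ 3 - 2 *\<^sub>R a ^ 3)"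
    unfolding cube_add_sub_one by (simp add: T)
  also have "\<dots> = R ((\<phi> a + 1) ^ 3 + (\<phi> a - 1) ^ 3 - 2 *\<^sub>R \<phi> a ^ 3)"
    by (simp only: T R cube shift)
  also have "\<dots> = 6 *\<^sub>R R (\<phi> a)"
    unfolding cube_add_sub_one by (simp add: R)
  finally show "T a = R (\<phi> a)" by simp
  have "6 *\<^sub>R T (a * a) = T ((a + 1) ^ 3 - (a - 1) ^ 3 - 2 *\<^sub>R 1)"
    unfolding cube_add_sub_one by (simp add: T)
  also have "\<dots> = R ((\<phi> a + 1) ^ 3 - (\<phi> a - 1) ^ 3 - 2 *\<^sub>R 1)"
    by (simp only: T R cube shift one)
  also have "\<dots> = 6 *\<^sub>R R (\<phi> a * \<phi> a)"
    unfolding cube_add_sub_one by (simp add: R)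
  finally show "T (a * a) = R (\<phi> a * \<phi> a)" by simp
qed

theorem theorem3p10:
  fixes act :: "'b::unital_complex_banach_algebra \<Rightarrow> 'a::unital_complex_banach_algebra \<Rightarrow> 'b"
    and \<phi> :: "'a \<Rightarrow> 'b"
    and w :: 'a
  assumes "right_module act"
    and "pseudo_3_jordan_hom act w \<phi>"
    and "\<phi> 1 = 1"
    and "right_separating_point act w"
    and "\<forall>x y :: 'b. x * y = y * x"
    and "\<forall>a b c. \<phi> (a * b * c * w) = \<phi> (a * c * b * w)"
  shows "\<forall>a b. \<phi> (a * b) = \<phi> a * \<phi> b"
proof (intro allI)
  fix a b :: 'a
  define T where "T = (\<lambda>a. \<phi> (a * w))"
  define R where "R = (\<lambda>y. act y w)"
  have lin_\<phi>: "linear \<phi>"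
    using assms(2) by (auto simp: pseudo_3_jordan_hom_def intro: clinear_imp_linear)
  have lin_R: "linear R"
    using assms(1) by (auto simp: right_module_def R_def intro: clinear_imp_linear)
  have lin_T: "linear T"
    unfolding T_def
    by (rule linearI)
      (simp_all add: distrib_right linear_add[OF lin_\<phi>] linear_scale[OF lin_\<phi>])
  have R_eqD: "x = y" if "R x = R y" for x y
  proof -
    have "R (x - y) = 0"
      using that by (simp add: linear_diff[OF lin_R])
    then show ?thesis
      using assms(4) by (auto simp: right_separating_point_def R_def)
  qed
  have cube: "T (c ^ 3) = R (\<phi> c ^ 3)" for c
    using assms(2) by (simp add: pseudo_3_jordan_hom_def T_def R_def)
  note descends = cube_identity_descends[OF lin_\<phi> lin_T lin_R assms(3) cube]
  have square: "\<phi> (c * c) = \<phi> c * \<phi> c" for c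
    by (rule R_eqD) (simp flip: descends)
  have "T (b * a) = T (a * b)"
    using assms(6)[rule_format, of 1 b a] by (simp add: T_def)
  then have sym: "\<phi> (b * a) = \<phi> (a * b)"
    unfolding descends(1) by (rule R_eqD)
  have "\<phi> (a * b) + \<phi> (b * a) = \<phi> a * \<phi> b + \<phi> b * \<phi> a"
    using square[of "a + b"]
    by (simp add: algebra_simps linear_add[OF lin_\<phi>] square)
  then have "2 *\<^sub>R \<phi> (a * b) = 2 *\<^sub>R (\<phi> a * \<phi> b)"
    using sym assms(5)[rule_format, of "\<phi> b" "\<phi> a"] by (simp add: scaleR_2)
  then show "\<phi> (a * b) = \<phi> a * \<phi> b" by simp
qed

end
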